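(* Every countable acyclic digraph is majority $3$-choosable: for every countable acyclic digraph $D$ and every assignment of lists $L(v)$, each consisting of exactly $3$ colours, to the vertices $v\in V(D)$, there is a majority colouring $\chi$ of $D$ with $\chi(v)\in L(v)$ for every $v$.
   Context: For a digraph $D$, a majority colouring is an assignment $\chi$ of colours to vertices such that for every vertex $v$: if $v$ has finite outdegree, at most half of the out-edges $v\to u$ are monochromatic (i.e. $\chi(u)=\chi(v)$); if $v$ has infinite outdegree, $v$ has infinitely many outneighbours $u$ with $\chi(u)\neq\chi(v)$. A digraph is majority $\ell$-choosable if for every system of lists $(L(v))_{v}$ with $|L(v)|=\ell$ there is a majority colouring $\chi$ with $\chi(v)\in L(v)$ for all $v$. A digraph is acyclic if it contains no directed cycle. *)

theory Defs
  imports "Graph_Theory.Graph_Theory" "HOL-Library.Countable_Set"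
begin

definition acyclic_digraph :: "('a, 'b) pre_digraph \<Rightarrow> bool" where
  "acyclic_digraph D \<longleftrightarrow> \<not> (\<exists>p. pre_digraph.cycle D p)"

definition majority_colouring :: "('a, 'b) pre_digraph \<Rightarrow> ('a \<Rightarrow> 'c) \<Rightarrow> bool" where
  "majority_colouring D \<chi> \<longleftrightarrow>
     (\<forall>v \<in> verts D.
        if finite (out_arcs D v)
        then 2 * card {e \<in> out_arcs D v. \<chi> (head D e) = \<chi> v} \<le> out_degree D v
        else infinite {u. v \<rightarrow>\<^bsub>D\<^esub> u \<and> \<chi> u \<noteq> \<chi> v})"

text \<open>
  The type argument names the type the colours are drawn from: a definition cannot quantify over
  types, so choosability for arbitrary colours is expressed by leaving \<open>'c\<close> a free type variable.
  Finiteness of the lists is implied by their cardinality except when \<open>l = 0\<close>.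
\<close>

definition majority_choosable :: "'c itself \<Rightarrow> ('a, 'b) pre_digraph \<Rightarrow> nat \<Rightarrow> bool" where
  "majority_choosable (_ :: 'c itself) D l \<longleftrightarrow>
     (\<forall>L :: 'a \<Rightarrow> 'c set.
        (\<forall>v \<in> verts D. finite (L v) \<and> card (L v) = l) \<longrightarrow>
        (\<exists>\<chi>. majority_colouring D \<chi> \<and> (\<forall>v \<in> verts D. \<chi> v \<in> L v)))"

end

theory Submission
  imports Defs "HOL-Analysis.Function_Topology"
begin

text \<open>
  Let \<open>I\<close> be the set of vertices of infinite outdegree, and enumerate all vertices. Choose pairwise
  disjoint infinite sets \<open>M v\<close> of outneighbours of \<open>v\<close>, for \<open>v \<in> I\<close>, such that every element of
  \<open>M v\<close> comes after \<open>v\<close> in the enumeration. Then every \<open>u\<close> has at most one parent, the vertex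
  \<open>v\<close> with \<open>u \<in> M v\<close>, and it suffices that each vertex gets a colour different from that of its
  parent and that the majority condition holds at the vertices outside \<open>I\<close>. Vertices in \<open>I\<close> are
  coloured first, greedily along the enumeration. Every other vertex still has two available
  colours, and by compactness it is enough to treat finitely many of these vertices, which are
  coloured greedily in an order in which outneighbours come first: one of the two colours occurs on
  at most half of the out-arcs.
\<close>

section \<open>Countable choice and compactness\<close>

lemma finite_to_nat_on_less:
  assumes "countable V"
  shows "finite {u \<in> V. to_nat_on V u < n}"
proof (rule inj_on_finite[of "to_nat_on V" _ "{..<n}"])
  show "inj_on (to_nat_on V) {u \<in> V. to_nat_on V u < n}"
    using inj_on_to_nat_on[OF assms] by (rule inj_on_subset) blast
qed auto

text \<open>Choose greedily along an enumeration of \<open>I\<close>: only finitely many values are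
  taken before \<open>i\<close>, so the infinite set \<open>A i\<close> still has a free one.
  Applied to pairs \<open>(v, k)\<close> with sets depending on \<open>v\<close> alone, it yields
  disjoint infinite sets all at once.\<close>

lemma countable_infinite_transversal:
  fixes A :: "'i \<Rightarrow> 'x set"
  assumes "countable I" and inf: "\<And>i. i \<in> I \<Longrightarrow> infinite (A i)"
  obtains h where "inj_on h I" and "\<And>i. i \<in> I \<Longrightarrow> h i \<in> A i"
proof -
  let ?idx = "to_nat_on I"
  let ?prev = "\<lambda>i. {j \<in> I. ?idx j < ?idx i}"
  let ?P = "\<lambda>h i r. i \<in> I \<longrightarrow> r \<in> A i \<and> r \<notin> h ` ?prev i"
  have inj: "inj_on ?idx I"
    using \<open>countable I\<close> by (rule inj_on_to_nat_on)
  have "\<exists>h. \<forall>i. ?P h i (h i)"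
  proof (rule dependent_wf_choice[of "measure ?idx"])
    fix h i
    have "finite (?prev i)"
      using \<open>countable I\<close> by (rule finite_to_nat_on_less)
    then have "infinite (A i - h ` ?prev i)" if "i \<in> I"
      using inf[OF that] by (simp add: Diff_infinite_finite)
    then have "A i - h ` ?prev i \<noteq> {}" if "i \<in> I"
      using infinite_imp_nonempty that by blast
    then show "\<exists>r. ?P h i r"
      by blast
  next
    fix f g :: "'i \<Rightarrow> 'x" and i r
    assume "\<And>z. (z, i) \<in> measure ?idx \<Longrightarrow> f z = g z"
    then have "f ` ?prev i = g ` ?prev i"
      by (intro image_cong) auto
    then show "?P f i r = ?P g i r"
      by simp
  qed simp
  then obtain h where h: "\<And>i. ?P h i (h i)"
    by blast
  have "inj_on h I"
  proof (rule inj_onI, rule ccontr)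
    fix i j assume ij: "i \<in> I" "j \<in> I" "h i = h j" "i \<noteq> j"
    then have "?idx i \<noteq> ?idx j"
      using inj by (auto dest: inj_onD)
    then show False
      \<comment> \<open>Whichever of \<open>i\<close> and \<open>j\<close> has the larger index was
        chosen to avoid the value at the other.\<close>
      using h[of i] h[of j] ij by (metis (mono_tags, lifting) image_eqI mem_Collect_eq nat_neq_iff)
  qed
  then show ?thesis
    using h that by blast
qed

text \<open>By Tychonoff, the product of the finite discrete lists is compact. Each constraint reads
  only the finitely many coordinates in \<open>T v\<close>, so it cuts out a closed set, and
  \<open>finsat\<close> supplies the finite intersection property.\<close>

lemma list_colouring_compactness:
  fixes L :: "'a \<Rightarrow> 'c set" and P :: "'a \<Rightarrow> ('a \<Rightarrow> 'c) \<Rightarrow> bool" and T :: "'a \<Rightarrow> 'a set"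
  assumes fin: "\<And>v. v \<in> V \<Longrightarrow> finite (L v)"
    and T: "\<And>v. v \<in> F \<Longrightarrow> finite (T v) \<and> T v \<subseteq> V"
    and local: "\<And>v \<chi> \<psi>. v \<in> F \<Longrightarrow> (\<And>u. u \<in> T v \<Longrightarrow> \<chi> u = \<psi> u) \<Longrightarrow> P v \<chi> \<longleftrightarrow> P v \<psi>"
    and finsat: "\<And>S. finite S \<Longrightarrow> S \<subseteq> F \<Longrightarrow> \<exists>\<chi>. (\<forall>v \<in> V. \<chi> v \<in> L v) \<and> (\<forall>v \<in> S. P v \<chi>)"
  shows "\<exists>\<chi>. (\<forall>v \<in> V. \<chi> v \<in> L v) \<and> (\<forall>v \<in> F. P v \<chi>)"
proof -
  define X where "X = product_topology (\<lambda>v. discrete_topology (L v)) V"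
  define C where "C v = {\<chi> \<in> Pi\<^sub>E V L. P v \<chi>}" for v
  have top: "topspace X = Pi\<^sub>E V L"
    by (simp add: X_def)
  have "compact_space X"
    unfolding X_def compact_space_product_topology
    using fin by (simp add: compact_space_discrete_topology)
  \<comment> \<open>The whole space joins the family so that the intersection consists of list
    colourings even when \<open>F\<close> is empty.\<close>
  moreover have "closedin X B" if B: "B \<in> insert (Pi\<^sub>E V L) (C ` F)" for B
  proof (cases "B = Pi\<^sub>E V L")
    case True
    then show ?thesis
      using top closedin_topspace by metis
  next
    case False
    then obtain v where v: "v \<in> F" "B = C v"
      using B by blast
    have "openin X (topspace X - C v)"
    proof (subst openin_subopen, intro ballI)
      fix \<chi> assume \<chi>: "\<chi> \<in> topspace X - C v"
      \<comment> \<open>A basic open neighbourhood of \<open>\<chi>\<close>: frozen on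
        \<open>T v\<close>, free elsewhere. By locality \<open>P v\<close> fails throughout
        it.\<close>
      define U where "U = Pi\<^sub>E V (\<lambda>u. if u \<in> T v then {\<chi> u} else L u)"
      have \<chi>L: "\<chi> \<in> Pi\<^sub>E V L" and nP: "\<not> P v \<chi>"
        using \<chi> by (auto simp: top C_def)
      have "finite {u \<in> V. (if u \<in> T v then {\<chi> u} else L u) \<noteq> L u}"
        by (rule finite_subset[of _ "T v"]) (use T v in auto)
      then have "openin X U"
        unfolding X_def U_def openin_PiE_gen using \<chi>L by (auto simp: PiE_iff)
      moreover have "\<chi> \<in> U"
        using \<chi>L by (auto simp: U_def PiE_iff)
      moreover have "U \<subseteq> topspace X - C v"
      proof
        fix \<psi> assume \<psi>: "\<psi> \<in> U"
        have eq: "\<chi> u = \<psi> u" if "u \<in> T v" for u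
          using \<psi> that T v by (fastforce simp: U_def PiE_iff split: if_splits)
        have "U \<subseteq> Pi\<^sub>E V L"
          unfolding U_def using \<chi>L by (intro PiE_mono) (simp add: PiE_iff)
        then have "\<psi> \<in> Pi\<^sub>E V L"
          using \<psi> by blast
        moreover have "\<not> P v \<psi>"
          using nP local[OF v(1), of \<chi> \<psi>] eq by blast
        ultimately show "\<psi> \<in> topspace X - C v"
          by (simp add: top C_def)
      qed
      ultimately show "\<exists>U. openin X U \<and> \<chi> \<in> U \<and> U \<subseteq> topspace X - C v"
        by blast
    qed
    moreover have "C v \<subseteq> topspace X"
      by (auto simp: C_def top)
    ultimately show ?thesis
      by (simp add: v closedin_def)
  qed
  moreover have "\<Inter>\<F> \<noteq> {}" if \<F>: "finite \<F>" "\<F> \<subseteq> insert (Pi\<^sub>E V L) (C ` F)" for \<F>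
  proof -
    have "finite (\<F> - {Pi\<^sub>E V L})" "\<F> - {Pi\<^sub>E V L} \<subseteq> C ` F"
      using \<F> by auto
    from finite_subset_image[OF this]
    obtain S where S: "S \<subseteq> F" "finite S" "\<F> - {Pi\<^sub>E V L} = C ` S"
      by (elim exE conjE)
    obtain \<chi> where \<chi>: "\<forall>v \<in> V. \<chi> v \<in> L v" "\<forall>v \<in> S. P v \<chi>"
      using finsat[OF S(2,1)] by blast
    \<comment> \<open>Points of the product are extensional; restricting to \<open>V\<close> changes
      nothing on \<open>T v\<close>.\<close>
    have "P v (restrict \<chi> V)" if "v \<in> S" for v
    proof -
      have "v \<in> F"
        using S(1) that by blast
      then have "P v \<chi> \<longleftrightarrow> P v (restrict \<chi> V)"
        by (rule local) (use T \<open>v \<in> F\<close> in auto)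
      then show ?thesis
        using \<chi> that by blast
    qed
    then have "restrict \<chi> V \<in> B" if "B \<in> insert (Pi\<^sub>E V L) (C ` S)" for B
      using that \<chi>(1) by (auto simp: C_def)
    moreover have "\<F> \<subseteq> insert (Pi\<^sub>E V L) (C ` S)"
      by (simp add: subset_insertI flip: S(3))
    ultimately have "restrict \<chi> V \<in> \<Inter>\<F>"
      by (meson InterI subsetD)
    then show ?thesis
      by (metis empty_iff)
  qed
  ultimately have "\<Inter>(insert (Pi\<^sub>E V L) (C ` F)) \<noteq> {}"
    unfolding compact_space_fip by metis
  then show ?thesis
    by (auto simp: C_def PiE_iff)
qed

section \<open>Finitely many vertices of finite outdegree\<close>

lemma exists_minority_value:
  fixes f :: "'e \<Rightarrow> 'c"
  assumes "finite E" and "2 \<le> card K"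
  shows "\<exists>k \<in> K. 2 * card {e \<in> E. f e = k} \<le> card E"
proof -
  obtain a b where ab: "a \<in> K" "b \<in> K" "a \<noteq> b"
    using assms(2) by (metis card_2_iff' obtain_subset_with_card_n subset_iff)
  \<comment> \<open>The fibres of two distinct values are disjoint, so they cannot both contain more
    than half of \<open>E\<close>.\<close>
  have "card {e \<in> E. f e = a} + card {e \<in> E. f e = b}
      = card ({e \<in> E. f e = a} \<union> {e \<in> E. f e = b})"
    using assms(1) ab(3) by (intro card_Un_disjoint[symmetric]) auto
  also have "\<dots> \<le> card E"
    using assms(1) by (intro card_mono) auto
  finally have "2 * card {e \<in> E. f e = a} \<le> card E \<or> 2 * card {e \<in> E. f e = b} \<le> card E"
    by linarith
  then show ?thesis
    using ab by blast
qed

text \<open>A pair \<open>(v, v)\<close> in the transitive closure comes from a nonempty closed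
  walk, and every such walk contains a cycle.\<close>

lemma (in wf_digraph) acyclic_arcs_ends:
  assumes "acyclic_digraph G"
  shows "acyclic (arcs_ends G)"
proof (rule acyclicI, intro allI notI)
  fix v assume "(v, v) \<in> (arcs_ends G)\<^sup>+"
  then obtain p where "awalk v p v" "p \<noteq> []"
    unfolding reachable1_awalk by blast
  then have "closed_w p"
    by (auto simp: closed_w_def)
  then show False
    using closed_w_imp_cycle assms by (auto simp: acyclic_digraph_def)
qed

lemma acyclic_finite_source:
  assumes "acyclic r" and "finite S" and "S \<noteq> {}"
  shows "\<exists>s \<in> S. \<forall>t \<in> S. (t, s) \<notin> r"
proof -
  have "wf (r \<inter> S \<times> S)"
    using assms(1,2) by (intro finite_acyclic_wf finite_Int) (simp_all add: acyclic_subset[OF _ Int_lower1])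
  then obtain s where "s \<in> S" "\<And>t. (t, s) \<in> r \<inter> S \<times> S \<Longrightarrow> t \<notin> S"
    using assms(3) by (metis wfE_min')
  then show ?thesis
    by blast
qed

text \<open>Induction on \<open>S\<close>: a vertex \<open>s\<close> of \<open>S\<close> without
  in-arcs from \<open>S\<close> is coloured last. Recolouring it affects no out-arc count at the
  other vertices of \<open>S\<close>, and one of two colours in its list is a minority among its
  outneighbours.\<close>

lemma (in wf_digraph) finite_acyclic_majority:
  fixes L :: "'a \<Rightarrow> 'c set"
  assumes acyc: "acyclic (arcs_ends G)"
    and ne: "\<And>v. v \<in> verts G \<Longrightarrow> L v \<noteq> {}"
    and "finite S" and "S \<subseteq> verts G"
    and "\<And>v. v \<in> S \<Longrightarrow> finite (out_arcs G v) \<and> 2 \<le> card (L v)"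
  shows "\<exists>\<chi>. (\<forall>v \<in> verts G. \<chi> v \<in> L v) \<and>
    (\<forall>v \<in> S. 2 * card {e \<in> out_arcs G v. \<chi> (head G e) = \<chi> v} \<le> out_degree G v)"
  using assms(3-)
proof (induction S rule: finite_psubset_induct)
  case (psubset S)
  show ?case
  proof (cases "S = {}")
    case True
    then show ?thesis
      using ne by (intro exI[of _ "\<lambda>v. SOME c. c \<in> L v"]) (simp add: some_in_eq)
  next
    case False
    then obtain s where s: "s \<in> S" "\<And>t. t \<in> S \<Longrightarrow> (t, s) \<notin> arcs_ends G"
      using acyclic_finite_source[OF acyc psubset.hyps(1)] by blast
    have "S - {s} \<subset> S"
      using s by blast
    then have "\<exists>\<chi>. (\<forall>v \<in> verts G. \<chi> v \<in> L v) \<and>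
        (\<forall>v \<in> S - {s}. 2 * card {e \<in> out_arcs G v. \<chi> (head G e) = \<chi> v} \<le> out_degree G v)"
      by (rule psubset.IH) (use psubset.prems in auto)
    then obtain \<chi> where \<chi>: "\<And>v. v \<in> verts G \<Longrightarrow> \<chi> v \<in> L v"
      "\<And>v. v \<in> S - {s} \<Longrightarrow> 2 * card {e \<in> out_arcs G v. \<chi> (head G e) = \<chi> v} \<le> out_degree G v"
      by blast
    obtain c where c: "c \<in> L s" "2 * card {e \<in> out_arcs G s. \<chi> (head G e) = c} \<le> out_degree G s"
      using exists_minority_value[of "out_arcs G s" "L s" "\<lambda>e. \<chi> (head G e)"] psubset.prems(2)[OF s(1)]
      by (auto simp: out_degree_def)
    let ?\<chi> = "\<chi>(s := c)"
    \<comment> \<open>The case \<open>v = s\<close> is included: there is no loop at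
      \<open>s\<close>, so its new colour does not alter the count that determined it.\<close>
    have head: "head G e \<noteq> s" if "v \<in> S" "e \<in> out_arcs G v" for v e
      using s(2)[OF that(1)] that(2) by (auto simp: arcs_ends_def arc_to_ends_def)
    have "2 * card {e \<in> out_arcs G v. ?\<chi> (head G e) = ?\<chi> v} \<le> out_degree G v" if v: "v \<in> S" for v
    proof -
      have "{e \<in> out_arcs G v. ?\<chi> (head G e) = ?\<chi> v} = {e \<in> out_arcs G v. \<chi> (head G e) = ?\<chi> v}"
        using head[OF v] by (metis fun_upd_other)
      then show ?thesis
        using \<chi>(2)[of v] c(2) v by (cases "v = s") simp_all
    qed
    then show ?thesis
      using \<chi>(1) c(1) by (intro exI[of _ ?\<chi>]) auto
  qed
qed

section \<open>Vertices of infinite outdegree\<close>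

lemma (in nomulti_digraph) infinite_outneighbours:
  assumes "infinite (out_arcs G v)"
  shows "infinite {u. v \<rightarrow>\<^bsub>G\<^esub> u}"
proof
  assume "finite {u. v \<rightarrow>\<^bsub>G\<^esub> u}"
  moreover have "head G ` out_arcs G v \<subseteq> {u. v \<rightarrow>\<^bsub>G\<^esub> u}"
    by (auto simp: arcs_ends_def arc_to_ends_def)
  ultimately have "finite (head G ` out_arcs G v)"
    by (rule rev_finite_subset)
  \<comment> \<open>Without parallel arcs, infinitely many out-arcs have infinitely many
    heads.\<close>
  moreover have "inj_on (head G) (out_arcs G v)"
    by (rule inj_onI, rule no_multi_arcs) (simp_all add: arc_to_ends_def)
  ultimately show False
    using assms by (blast dest: finite_imageD)
qed

text \<open>Since \<open>idx\<close> drops from \<open>u\<close> to \<open>p u\<close>, colours can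
  be chosen by recursion on \<open>idx\<close>; each step forbids one colour out of at least
  two.\<close>

lemma greedy_parent_colouring:
  fixes L :: "'a \<Rightarrow> 'c set" and idx :: "'a \<Rightarrow> nat"
  assumes lists: "\<And>u. u \<in> V \<Longrightarrow> 2 \<le> card (L u)"
    and parent: "\<And>u. u \<in> H \<Longrightarrow> idx (p u) < idx u"
  shows "\<exists>c. \<forall>u \<in> V. c u \<in> L u \<and> (u \<in> H \<longrightarrow> c u \<noteq> c (p u))"
proof -
  let ?P = "\<lambda>c u r. u \<in> V \<longrightarrow> r \<in> L u \<and> (u \<in> H \<longrightarrow> r \<noteq> c (p u))"
  have "\<exists>c. \<forall>u. ?P c u (c u)"
  proof (rule dependent_wf_choice[of "measure idx"])
    fix c :: "'a \<Rightarrow> 'c" and u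
    have "\<not> L u \<subseteq> {c (p u)}" if "u \<in> V"
      using lists[OF that] card_mono[of "{c (p u)}" "L u"] by auto
    then show "\<exists>r. ?P c u r"
      by blast
  next
    fix f g :: "'a \<Rightarrow> 'c" and u r
    assume "\<And>z. (z, u) \<in> measure idx \<Longrightarrow> f z = g z"
    then show "?P f u r = ?P g u r"
      using parent by auto
  qed simp
  then show ?thesis
    by blast
qed

section \<open>Combining the greedy and the compactness colourings\<close>

theorem theorem6:
  fixes D :: "('a, 'b) pre_digraph"
  assumes "nomulti_digraph D"
    and "countable (verts D)"
    and "acyclic_digraph D"
  shows "majority_choosable TYPE('c) D 3"
  unfolding majority_choosable_def
proof (intro allI impI)
  interpret nomulti_digraph D by fact
  fix L :: "'a \<Rightarrow> 'c set"
  assume L: "\<forall>v \<in> verts D. finite (L v) \<and> card (L v) = 3"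
  define I where "I = {v \<in> verts D. infinite (out_arcs D v)}"
  let ?V = "verts D" and ?idx = "to_nat_on (verts D)"
  define A where "A v = {u. v \<rightarrow>\<^bsub>D\<^esub> u \<and> ?idx v < ?idx u}" for v
  have dom_verts: "u \<in> ?V" if "v \<rightarrow>\<^bsub>D\<^esub> u" for u v
    using that by (auto dest: adj_in_verts)
  have infA: "infinite (A v)" if "v \<in> I" for v
  proof
    assume "finite (A v)"
    \<comment> \<open>\<open>Suc\<close> includes index \<open>?idx v\<close> itself, complementing
      the strict inequality in \<open>A v\<close>. Hence passing to \<open>A v\<close> loses only
      finitely many outneighbours.\<close>
    moreover have "finite {u \<in> ?V. ?idx u < Suc (?idx v)}"
      using \<open>countable ?V\<close> by (rule finite_to_nat_on_less)
    moreover have "{u. v \<rightarrow>\<^bsub>D\<^esub> u} \<subseteq> A v \<union> {u \<in> ?V. ?idx u < Suc (?idx v)}"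
      by (auto simp: A_def dom_verts)
    ultimately have "finite {u. v \<rightarrow>\<^bsub>D\<^esub> u}"
      by (meson finite_UnI finite_subset)
    then show False
      using infinite_outneighbours that by (auto simp: I_def)
  qed
  have "countable (I \<times> (UNIV :: nat set))"
    using \<open>countable ?V\<close> by (auto simp: I_def)
  then obtain h where inj: "inj_on h (I \<times> (UNIV :: nat set))"
    and h: "\<And>i. i \<in> I \<times> UNIV \<Longrightarrow> h i \<in> A (fst i)"
    by (rule countable_infinite_transversal[where A = "\<lambda>i. A (fst i)"]) (auto simp: infA)
  \<comment> \<open>\<open>M v\<close> is the set of all \<open>h (v, k)\<close>, and
    \<open>H\<close> is the union of these sets. Injectivity of \<open>h\<close> makes the parent
    \<open>p u\<close> well determined on \<open>H\<close>; off \<open>H\<close> its value is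
    arbitrary.\<close>
  define H where "H = h ` (I \<times> UNIV)"
  define p where "p u = fst (inv_into (I \<times> UNIV) h u)" for u
  have p: "p (h (v, k)) = v" if "v \<in> I" for v k
    using inj that by (simp add: p_def)
  have "?idx (p u) < ?idx u" if "u \<in> H" for u
    using that p h by (fastforce simp: H_def A_def)
  then have "\<exists>c. \<forall>u \<in> ?V. c u \<in> L u \<and> (u \<in> H \<longrightarrow> c u \<noteq> c (p u))"
    using L by (intro greedy_parent_colouring[where idx = ?idx]) simp_all
  then obtain c where c: "\<And>u. u \<in> ?V \<Longrightarrow> c u \<in> L u"
    "\<And>u. u \<in> ?V \<Longrightarrow> u \<in> H \<Longrightarrow> c u \<noteq> c (p u)"
    by blast
  \<comment> \<open>The lists \<open>L'\<close> encode the parent condition: they fix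
    \<open>c\<close> on \<open>I\<close> and delete the parent's colour on the rest of
    \<open>H\<close>. Parents lie in \<open>I\<close>, so the deleted colour is the one the parent
    finally gets.\<close>
  define L' where "L' u = (if u \<in> I then {c u} else if u \<in> H then L u - {c (p u)} else L u)" for u
  have L'_fin: "finite (L' u)" if "u \<in> ?V" for u
    using that L by (simp add: L'_def)
  have L'_sub: "L' u \<subseteq> L u" if "u \<in> ?V" for u
    using that c by (auto simp: L'_def)
  have L'_card: "2 \<le> card (L' u)" if "u \<in> ?V - I" for u
    using that L card_Diff_singleton_if[of "L u" "c (p u)"] by (auto simp: L'_def)
  have L'_ne: "L' u \<noteq> {}" if "u \<in> ?V" for u
  proof (cases "u \<in> I")
    case False
    then show ?thesis
      using L'_card[of u] that by force
  qed (simp add: L'_def)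
  let ?P = "\<lambda>v \<chi>. 2 * card {e \<in> out_arcs D v. \<chi> (head D e) = \<chi> v} \<le> out_degree D v"
  have "\<exists>\<chi>. (\<forall>v \<in> ?V. \<chi> v \<in> L' v) \<and> (\<forall>v \<in> ?V - I. ?P v \<chi>)"
  \<comment> \<open>The condition at \<open>v\<close> reads the colours of \<open>v\<close> and of
    its outneighbours only, a finite set for \<open>v\<close> outside \<open>I\<close>.\<close>
  proof (rule list_colouring_compactness[where T = "\<lambda>v. insert v (head D ` out_arcs D v)"])
    fix v and \<chi> \<psi> :: "'a \<Rightarrow> 'c"
    assume "\<And>u. u \<in> insert v (head D ` out_arcs D v) \<Longrightarrow> \<chi> u = \<psi> u"
    then have "{e \<in> out_arcs D v. \<chi> (head D e) = \<chi> v} = {e \<in> out_arcs D v. \<psi> (head D e) = \<psi> v}"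
      by auto
    then show "?P v \<chi> = ?P v \<psi>"
      by simp
  next
    fix S assume "finite S" "S \<subseteq> ?V - I"
    then show "\<exists>\<chi>. (\<forall>v \<in> ?V. \<chi> v \<in> L' v) \<and> (\<forall>v \<in> S. ?P v \<chi>)"
      using L'_card L'_ne
      by (intro finite_acyclic_majority acyclic_arcs_ends \<open>acyclic_digraph D\<close>) (auto simp: I_def)
  qed (auto simp: L'_fin I_def)
  then obtain \<chi> where \<chi>: "\<And>v. v \<in> ?V \<Longrightarrow> \<chi> v \<in> L' v" "\<And>v. v \<in> ?V - I \<Longrightarrow> ?P v \<chi>"
    by blast
  have "infinite {u. v \<rightarrow>\<^bsub>D\<^esub> u \<and> \<chi> u \<noteq> \<chi> v}" if v: "v \<in> I" for v
  proof -
    have "inj (\<lambda>k. h (v, k))"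
      using inj v by (auto simp: inj_on_def)
    then have "infinite (range (\<lambda>k. h (v, k)))"
      by (simp add: finite_image_iff)
    moreover have "range (\<lambda>k. h (v, k)) \<subseteq> {u. v \<rightarrow>\<^bsub>D\<^esub> u \<and> \<chi> u \<noteq> \<chi> v}"
    proof safe
      fix k
      show dom: "v \<rightarrow>\<^bsub>D\<^esub> h (v, k)"
        using h[of "(v, k)"] v by (simp add: A_def)
      have "h (v, k) \<in> H"
        using v by (auto simp: H_def)
      \<comment> \<open>If \<open>h (v, k)\<close> lies in \<open>I\<close>, it has its
        \<open>c\<close>-colour, which differs from that of its parent \<open>v\<close>; otherwise
        \<open>c v\<close> was deleted from its list.\<close>
      then have "\<chi> (h (v, k)) \<noteq> c v"
        using \<chi>(1)[OF dom_verts[OF dom]] c(2)[OF dom_verts[OF dom]] p[OF v]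
        by (auto simp: L'_def split: if_splits)
      moreover have "\<chi> v = c v"
        using \<chi>(1)[of v] v by (simp add: L'_def I_def)
      moreover assume "\<chi> (h (v, k)) = \<chi> v"
      ultimately show False
        by simp
    qed
    ultimately show ?thesis
      by (meson finite_subset)
  qed
  then have "majority_colouring D \<chi>"
    using \<chi>(2) by (simp add: majority_colouring_def I_def)
  then show "\<exists>\<chi>. majority_colouring D \<chi> \<and> (\<forall>v \<in> ?V. \<chi> v \<in> L v)"
    using \<chi>(1) L'_sub by blast
qed

end
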